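(* Let $A,B$ be $n\times n$ Hermitian positive definite matrices. Then $$8\,\delta_S^2(A,B)\le\delta_R^2(A,B)\le 2\,\delta_T(A,B)\bigl(\delta_S^2(A,B)+n\log 2\bigr).$$
   Context: For Hermitian positive definite $A,B$: $\delta_S^2(A,B):=\log\det\left(\frac{A+B}{2}\right)-\frac12\log\det(AB)$; $\delta_R(A,B):=\|\log(B^{-1/2}AB^{-1/2})\|_F=\left(\sum_i\log^2\lambda_i(AB^{-1})\right)^{1/2}$ is the Riemannian distance; $\delta_T(A,B):=\max_i|\log\lambda_i(AB^{-1})|$ is the Thompson metric, where $\lambda_i(AB^{-1})$ are the (positive) eigenvalues of $AB^{-1}$. *)

theory Defs
  imports
    Complex_Main
    "Jordan_Normal_Form.Spectral_Radius"
    "Jordan_Normal_Form.Schur_Decomposition"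
    "Jordan_Normal_Form.Gauss_Jordan_Elimination"
begin

definition hermitian_mat :: "complex mat \<Rightarrow> bool" where
  "hermitian_mat A \<longleftrightarrow> square_mat A \<and> mat_adjoint A = A"

text \<open>Since \<open>x \<bullet>c y\<close> conjugates its second argument, \<open>(A *\<^sub>v v) \<bullet>c v\<close> is the Hermitian
  form $v^* A v$, which is real whenever \<open>A\<close> is Hermitian.\<close>

definition hpd_mat :: "complex mat \<Rightarrow> bool" where
  "hpd_mat A \<longleftrightarrow> hermitian_mat A \<and>
     (\<forall>v \<in> carrier_vec (dim_row A). v \<noteq> 0\<^sub>v (dim_row A) \<longrightarrow> Re ((A *\<^sub>v v) \<bullet>c v) > 0)"

definition unitary_mat :: "complex mat \<Rightarrow> bool" where
  "unitary_mat U \<longleftrightarrow> square_mat U \<and> mat_adjoint U * U = 1\<^sub>m (dim_row U)"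

definition frobenius_norm :: "complex mat \<Rightarrow> real" where
  "frobenius_norm A = sqrt (\<Sum>i<dim_row A. \<Sum>j<dim_col A. (cmod (A $$ (i, j)))\<^sup>2)"

text \<open>The matrix $f(H) = U\,\mathrm{diag}(f(d_0),\ldots,f(d_{n-1}))\,U^*$ for a Hermitian matrix
  $H = U\,\mathrm{diag}(d_0,\ldots,d_{n-1})\,U^*$; it does not depend on the chosen unitary
  diagonalization.\<close>

definition hermitian_fun :: "(real \<Rightarrow> real) \<Rightarrow> complex mat \<Rightarrow> complex mat" where
  "hermitian_fun f H = (THE X. \<exists>U d.
     U \<in> carrier_mat (dim_row H) (dim_row H) \<and> unitary_mat U \<and>
     H = U * mat_diag (dim_row H) (\<lambda>i. complex_of_real (d i)) * mat_adjoint U \<and>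
     X = U * mat_diag (dim_row H) (\<lambda>i. complex_of_real (f (d i))) * mat_adjoint U)"

definition log_mat :: "complex mat \<Rightarrow> complex mat" where
  "log_mat = hermitian_fun ln"

definition inv_sqrt_mat :: "complex mat \<Rightarrow> complex mat" where
  "inv_sqrt_mat = hermitian_fun (\<lambda>x. x powr (- 1 / 2))"

text \<open>All functions below are meant for Hermitian positive definite arguments of equal dimension.
  Then the determinants are positive reals and the eigenvalues of $A B^{-1}$ are positive
  reals, so that taking real parts only changes the type.\<close>

definition delta_S_sq :: "complex mat \<Rightarrow> complex mat \<Rightarrow> real" where
  "delta_S_sq A B =
     ln (Re (det ((1 / 2) \<cdot>\<^sub>m (A + B)))) - 1 / 2 * ln (Re (det (A * B)))"

definition delta_R :: "complex mat \<Rightarrow> complex mat \<Rightarrow> real" where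
  "delta_R A B = frobenius_norm (log_mat (inv_sqrt_mat B * A * inv_sqrt_mat B))"

definition delta_T :: "complex mat \<Rightarrow> complex mat \<Rightarrow> real" where
  "delta_T A B =
     Max ((\<lambda>l. \<bar>ln (Re l)\<bar>) ` spectrum (A * the (mat_inverse B)))"

end

theory Submission
  imports Defs
begin

text \<open>All three quantities depend only on the eigenvalues $\lambda_i = e^{u_i}$ of
  $M = B^{-1/2} A B^{-1/2}$, which is similar to $A B^{-1}$:
  $\delta_R^2 = \sum_i u_i^2$, $\delta_S^2 = \sum_i \log\cosh(u_i/2)$ and
  $\delta_T = \max_i |u_i|$. The lower bound on $\delta_R^2$ is $\cosh x \le e^{x^2/2}$ applied
  termwise; the upper bound is $u_i^2 \le \delta_T |u_i|$ together with
  $|x| \le \log(2 \cosh x)$.\<close>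

section \<open>Adjoints and unitary matrices\<close>

lemma dim_mat_adjoint [simp]:
  "dim_row (mat_adjoint A) = dim_col A" "dim_col (mat_adjoint A) = dim_row A"
  by (auto simp: mat_adjoint_def)

lemma mat_adjoint_carrier [simp]:
  "A \<in> carrier_mat nr nc \<Longrightarrow> mat_adjoint A \<in> carrier_mat nc nr"
  by (auto intro!: carrier_matI)

lemma index_mat_adjoint [simp]:
  "i < dim_col A \<Longrightarrow> j < dim_row A \<Longrightarrow> mat_adjoint A $$ (i, j) = conjugate (A $$ (j, i))"
  by (auto simp: mat_adjoint_def mat_of_rows_index)

lemma mat_adjoint_adjoint [simp]: "mat_adjoint (mat_adjoint A) = A"
  by (rule eq_matI) auto

lemma mat_adjoint_mult:
  fixes A B :: "complex mat"
  assumes "A \<in> carrier_mat nr n" "B \<in> carrier_mat n nc"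
  shows "mat_adjoint (A * B) = mat_adjoint B * mat_adjoint A"
  using assms by (intro eq_matI) (auto simp: scalar_prod_def mult.commute)

lemma mat_adjoint_one [simp]: "mat_adjoint (1\<^sub>m n :: complex mat) = 1\<^sub>m n"
  by (rule eq_matI) auto

lemma mat_adjoint_diag_real [simp]:
  "mat_adjoint (mat_diag n (\<lambda>i. complex_of_real (d i))) = mat_diag n (\<lambda>i. complex_of_real (d i))"
  by (rule eq_matI) (auto simp: mat_diag_def)

lemma mat_adjoint_four_block:
  fixes A B C D :: "complex mat"
  assumes "A \<in> carrier_mat nr1 nc1" "B \<in> carrier_mat nr1 nc2"
    "C \<in> carrier_mat nr2 nc1" "D \<in> carrier_mat nr2 nc2"
  shows "mat_adjoint (four_block_mat A B C D) =
    four_block_mat (mat_adjoint A) (mat_adjoint C) (mat_adjoint B) (mat_adjoint D)"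
  using assms by (intro eq_matI) auto

lemma cscalar_prod_mat_adjoint:
  fixes P :: "complex mat"
  assumes P: "P \<in> carrier_mat n m" and x: "x \<in> carrier_vec n" and v: "v \<in> carrier_vec m"
  shows "(mat_adjoint P *\<^sub>v x) \<bullet>c v = x \<bullet>c (P *\<^sub>v v)"
proof -
  have "(mat_adjoint P *\<^sub>v x) \<bullet>c v = (\<Sum>i<m. (\<Sum>j<n. cnj (P $$ (j, i)) * x $ j) * cnj (v $ i))"
    using assms by (auto simp: scalar_prod_def atLeast0LessThan intro!: sum.cong)
  also have "\<dots> = (\<Sum>i<m. \<Sum>j<n. x $ j * (cnj (P $$ (j, i)) * cnj (v $ i)))"
    by (simp add: sum_distrib_right sum_distrib_left mult_ac)
  also have "\<dots> = (\<Sum>j<n. \<Sum>i<m. x $ j * (cnj (P $$ (j, i)) * cnj (v $ i)))"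
    by (rule sum.swap)
  also have "\<dots> = x \<bullet>c (P *\<^sub>v v)"
    using assms by (auto simp: scalar_prod_def atLeast0LessThan sum_distrib_left intro!: sum.cong)
  finally show ?thesis .
qed

lemma unitary_matD:
  assumes "unitary_mat U" "U \<in> carrier_mat n n"
  shows "mat_adjoint U * U = 1\<^sub>m n" "U * mat_adjoint U = 1\<^sub>m n"
proof -
  show 1: "mat_adjoint U * U = 1\<^sub>m n" using assms by (auto simp: unitary_mat_def)
  show "U * mat_adjoint U = 1\<^sub>m n"
    by (rule mat_mult_left_right_inverse[OF _ _ 1]) (use assms in auto)
qed

lemma unitary_matI:
  "U \<in> carrier_mat n n \<Longrightarrow> mat_adjoint U * U = 1\<^sub>m n \<Longrightarrow> unitary_mat U"
  by (auto simp: unitary_mat_def)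

text \<open>With all dimensions equal, the conclusion fixes every variable of the premises, so the
  simplifier can discharge the carrier conditions of long products without guessing a middle
  dimension.\<close>

lemma sq_mult_carrier [simp]:
  "A \<in> carrier_mat n n \<Longrightarrow> B \<in> carrier_mat n n \<Longrightarrow> A * B \<in> carrier_mat n n"
  by simp

lemmas sq_mat_assoc = assoc_mult_mat[where n\<^sub>1 = n and n\<^sub>2 = n and n\<^sub>3 = n and n\<^sub>4 = n for n]

text \<open>The trailing \<open>X\<close> makes this usable in a right-associated product, where
  \<open>P * Q\<close> need not occur as a subterm. Together with \<open>sq_mat_assoc\<close> it
  cancels adjacent inverses anywhere in a word of square matrices.\<close>

lemma mult_cancel_inverse:
  fixes P Q X :: "'a :: semiring_1 mat"
  assumes "P * Q = 1\<^sub>m n" "P \<in> carrier_mat n n" "Q \<in> carrier_mat n n" "X \<in> carrier_mat n n"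
  shows "P * (Q * X) = X"
  using assms left_mult_one_mat[OF assms(4)] assoc_mult_mat[of P n n Q n X n] by simp

lemma unitary_mat_mult:
  assumes U: "U \<in> carrier_mat n n" "unitary_mat U" and V: "V \<in> carrier_mat n n" "unitary_mat V"
  shows "unitary_mat (U * V)"
proof (rule unitary_matI)
  show "U * V \<in> carrier_mat n n" using U V by simp
  have "mat_adjoint (U * V) * (U * V) = mat_adjoint V * (mat_adjoint U * (U * V))"
    using U V by (simp add: mat_adjoint_mult[of _ n n _ n] sq_mat_assoc[of _ n])
  also have "mat_adjoint U * (U * V) = V"
    by (rule mult_cancel_inverse[of _ _ n]) (use U V unitary_matD in auto)
  finally show "mat_adjoint (U * V) * (U * V) = 1\<^sub>m n" using V unitary_matD by simp
qed

text \<open>A bridge between the two forms of a diagonalization: block computations produce the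
  right-hand one, while functional calculus needs the left-hand one.\<close>

lemma conjugation_iff:
  assumes U: "U \<in> carrier_mat n n" "unitary_mat U" and "A \<in> carrier_mat n n" "D \<in> carrier_mat n n"
  shows "A = U * D * mat_adjoint U \<longleftrightarrow> mat_adjoint U * A * U = D"
proof -
  note c = unitary_matD[OF U(2,1)]
  have "mat_adjoint U * (U * D * mat_adjoint U) * U = D"
    using assms c by (simp add: sq_mat_assoc[of _ n] mult_cancel_inverse[of _ _ n])
  moreover have "U * (mat_adjoint U * A * U) * mat_adjoint U = A"
    using assms c by (simp add: sq_mat_assoc[of _ n] mult_cancel_inverse[of _ _ n])
  ultimately show ?thesis by metis
qed

section \<open>The spectral theorem for Hermitian matrices\<close>

text \<open>Complete \<open>v\<close> to a basis, orthogonalize by Gram-Schmidt, which keeps the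
  first vector, and normalize the columns; \<open>c\<close> absorbs the normalization. Applied to an
  eigenvector, this is the deflation step of the spectral theorem.\<close>

lemma exists_unitary_hd_col:
  fixes v :: "complex vec"
  assumes v: "v \<in> carrier_vec n" and v0: "v \<noteq> 0\<^sub>v n"
  shows "\<exists>W c. W \<in> carrier_mat n n \<and> unitary_mat W \<and> col W 0 = c \<cdot>\<^sub>v v"
proof -
  interpret cof_vec_space n "TYPE(complex)" .
  define b where "b = basis_completion v"
  define ws where "ws = gram_schmidt n b"
  note bc = basis_completion[OF v v0, folded b_def]
  have n: "n > 0" using v v0 by (cases n) auto
  obtain vs where bv: "b = v # vs" using bc(6,7) n by (cases b) auto
  have ws: "set ws \<subseteq> carrier_vec n" "corthogonal ws" "length ws = n"
    using gram_schmidt_result[OF bc(2,4,5) refl, folded ws_def] bc(6) by auto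
  have hd: "ws ! 0 = v"
    using gram_schmidt_hd[OF v, of vs, folded bv ws_def] ws(3) n hd_conv_nth[of ws] by auto
  have wsc: "ws ! i \<in> carrier_vec n" if "i < n" for i using ws that by auto
  \<comment> \<open>\<open>corthogonal\<close> gives pairwise orthogonal nonzero vectors, not unit
    ones, so each is divided by its length. Taking \<open>Re\<close> loses nothing, as
    \<open>pos\<close> shows below.\<close>
  define r where "r i = complex_of_real (1 / sqrt (Re (ws ! i \<bullet>c ws ! i)))" for i
  define W where "W = mat_of_cols n (map (\<lambda>i. r i \<cdot>\<^sub>v ws ! i) [0..<n])"
  have W: "W \<in> carrier_mat n n" by (auto simp: W_def)
  have colW: "col W i = r i \<cdot>\<^sub>v ws ! i" if "i < n" for i
    using that wsc[OF that] unfolding W_def by (subst col_mat_of_cols) auto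
  have pos: "Re (ws ! i \<bullet>c ws ! i) > 0" "Im (ws ! i \<bullet>c ws ! i) = 0" if "i < n" for i
  proof -
    have "ws ! i \<bullet>c ws ! i \<ge> 0" by auto
    moreover have "ws ! i \<bullet>c ws ! i \<noteq> 0" using corthogonalD[OF ws(2)] that ws(3) by auto
    ultimately show "Re (ws ! i \<bullet>c ws ! i) > 0" "Im (ws ! i \<bullet>c ws ! i) = 0"
      by (auto simp: less_eq_complex_def complex_eq_iff)
  qed
  have "mat_adjoint W * W = 1\<^sub>m n"
  proof (rule eq_matI)
    fix i j assume "i < dim_row (1\<^sub>m n :: complex mat)" "j < dim_col (1\<^sub>m n :: complex mat)"
    hence i: "i < n" and j: "j < n" by auto
    have "(mat_adjoint W * W) $$ (i, j) = (\<Sum>k<n. cnj (col W i $ k) * col W j $ k)"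
      using W i j by (auto simp: scalar_prod_def atLeast0LessThan)
    also have "\<dots> = cnj (r i) * r j * (\<Sum>k<n. ws ! j $ k * cnj (ws ! i $ k))"
      using wsc[OF i] wsc[OF j] by (auto simp: colW i j sum_distrib_left intro!: sum.cong)
    also have "(\<Sum>k<n. ws ! j $ k * cnj (ws ! i $ k)) = ws ! j \<bullet>c ws ! i"
      using wsc[OF i] wsc[OF j] by (auto simp: scalar_prod_def atLeast0LessThan)
    also have "cnj (r i) * r j * (ws ! j \<bullet>c ws ! i) = 1\<^sub>m n $$ (i, j)"
    proof (cases "i = j")
      case True
      define q where "q = Re (ws ! j \<bullet>c ws ! j)"
      have "ws ! j \<bullet>c ws ! j = complex_of_real q" using pos[OF j] by (simp add: q_def complex_eq_iff)
      moreover have "q > 0" using pos[OF j] by (simp add: q_def)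
      moreover have "1 / sqrt q * (1 / sqrt q) * q = 1" using \<open>q > 0\<close> by simp
      ultimately show ?thesis using True j
        by (simp add: r_def flip: of_real_mult of_real_divide)
    next
      case False
      thus ?thesis using corthogonalD[OF ws(2)] i j ws(3) by auto
    qed
    finally show "(mat_adjoint W * W) $$ (i, j) = 1\<^sub>m n $$ (i, j)" .
  qed (use W in auto)
  hence "unitary_mat W" using W by (auto intro: unitary_matI)
  thus ?thesis using W colW[OF n] hd by auto
qed

text \<open>Induction on the dimension: a unitary change of basis puts an eigenvector first, the
  Hermitian symmetry then clears the first row as well as the first column, and the remaining block
  is Hermitian of size one less.\<close>

lemma spectral_theorem_hermitian:
  fixes A :: "complex mat"
  assumes "A \<in> carrier_mat n n" and "mat_adjoint A = A"
  obtains U d where "U \<in> carrier_mat n n" "unitary_mat U"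
    "A = U * mat_diag n (\<lambda>i. complex_of_real (d i)) * mat_adjoint U"
proof -
  have "\<exists>U d. U \<in> carrier_mat n n \<and> unitary_mat U \<and>
    A = U * mat_diag n (\<lambda>i. complex_of_real (d i)) * mat_adjoint U"
    using assms
  proof (induction n arbitrary: A)
    case 0
    show ?case
      by (rule exI[of _ "1\<^sub>m 0"]) (use 0 in \<open>auto simp: unitary_mat_def intro!: eq_matI\<close>)
  next
    case (Suc m)
    let ?n = "Suc m"
    note A = Suc.prems(1)
    obtain e v where "eigenvector A v e"
      using spectrum_non_empty[OF A] by (auto simp: spectrum_def eigenvalue_def)
    hence v: "v \<in> carrier_vec ?n" "v \<noteq> 0\<^sub>v ?n" and ev: "A *\<^sub>v v = e \<cdot>\<^sub>v v"
      using A by (auto simp: eigenvector_def)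
    obtain W c where W: "W \<in> carrier_mat ?n ?n" "unitary_mat W" and c: "col W 0 = c \<cdot>\<^sub>v v"
      using exists_unitary_hd_col[OF v] by auto
    note WW = unitary_matD[OF W(2,1)]
    define A' where "A' = mat_adjoint W * A * W"
    have A': "A' \<in> carrier_mat ?n ?n" using A W by (simp add: A'_def)
    have adjA': "mat_adjoint A' = A'"
      using A W Suc.prems(2) by (simp add: A'_def mat_adjoint_mult[of _ ?n ?n _ ?n] sq_mat_assoc[of _ ?n])
    \<comment> \<open>Scaling by \<open>c\<close> preserves the eigenvector equation. Hence
      \<open>A'\<close> maps the first unit vector to \<open>e\<close> times itself, which
      determines its first column.\<close>
    have "A *\<^sub>v col W 0 = e \<cdot>\<^sub>v col W 0"
      unfolding c using A v ev by (auto simp: mult_mat_vec smult_smult_assoc mult.commute)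
    hence "col (A * W) 0 = e \<cdot>\<^sub>v col W 0" using A W by (subst col_mult2) auto
    moreover have "col A' 0 = mat_adjoint W *\<^sub>v col (A * W) 0"
      using A W col_mult2[of "mat_adjoint W" ?n ?n "A * W" ?n 0] by (simp add: A'_def sq_mat_assoc[of _ ?n])
    moreover have "mat_adjoint W *\<^sub>v col W 0 = col (1\<^sub>m ?n) 0"
      unfolding WW(1)[symmetric] using W by (subst col_mult2) auto
    ultimately have "col A' 0 = e \<cdot>\<^sub>v unit_vec ?n 0"
      using mult_mat_vec[OF mat_adjoint_carrier[OF W(1)], of "col W 0" e] col_carrier_vec[of 0 ?n W] W by simp
    hence c0: "A' $$ (i, 0) = (if i = 0 then e else 0)" if "i < ?n" for i
      using that A' by (auto simp: vec_eq_iff)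
    have r0: "A' $$ (0, i) = (if i = 0 then cnj e else 0)" if "i < ?n" for i
    proof -
      have "A' $$ (0, i) = mat_adjoint A' $$ (0, i)" by (simp add: adjA')
      also have "\<dots> = cnj (A' $$ (i, 0))" using A' that by simp
      finally show ?thesis using c0[OF that] by simp
    qed
    \<comment> \<open>The corner entry lies in both the first row and the first column, so the
      eigenvalue is real.\<close>
    have cnj_e: "cnj e = e" using c0[of 0] r0[of 0] by simp
    hence e: "e = complex_of_real (Re e)" by (simp add: complex_eq_iff)
    define A3 where "A3 = mat m m (\<lambda>(i, j). A' $$ (Suc i, Suc j))"
    have A3: "A3 \<in> carrier_mat m m" by (simp add: A3_def)
    have blk: "A' = four_block_mat (mat 1 1 (\<lambda>_. e)) (0\<^sub>m 1 m) (0\<^sub>m m 1) A3"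
      by (rule eq_matI) (use A' c0 r0 cnj_e in \<open>auto simp: A3_def\<close>)
    have "mat_adjoint A3 = A3"
    proof (rule eq_matI)
      fix i j assume "i < dim_row A3" "j < dim_col A3"
      hence ij: "i < m" "j < m" using A3 by auto
      have "cnj (A' $$ (Suc j, Suc i)) = mat_adjoint A' $$ (Suc i, Suc j)" using A' ij by simp
      thus "mat_adjoint A3 $$ (i, j) = A3 $$ (i, j)" using A3 ij by (simp add: A3_def adjA')
    qed (use A3 in auto)
    then obtain V d where V: "V \<in> carrier_mat m m" "unitary_mat V"
      and VD: "A3 = V * mat_diag m (\<lambda>i. complex_of_real (d i)) * mat_adjoint V"
      using Suc.IH[OF A3] by auto
    have D3: "mat_adjoint V * A3 * V = mat_diag m (\<lambda>i. complex_of_real (d i))"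
      using conjugation_iff[OF V A3, of "mat_diag m (\<lambda>i. complex_of_real (d i))"] VD by simp
    \<comment> \<open>Extending \<open>V\<close> by a 1 in the corner diagonalizes the lower block
      and leaves the eigenvalue \<open>e\<close> untouched; \<open>d'\<close> is \<open>d\<close>
      shifted by one with \<open>e\<close> in front.\<close>
    define Y where "Y = four_block_mat (1\<^sub>m 1) (0\<^sub>m 1 m) (0\<^sub>m m 1) V"
    define d' where "d' i = (if i = 0 then Re e else d (i - 1))" for i
    have Y: "Y \<in> carrier_mat ?n ?n" using V four_block_carrier_mat[of "1\<^sub>m 1" 1 1 V m m] by (simp add: Y_def)
    have z: "mat_adjoint (0\<^sub>m 1 m :: complex mat) = 0\<^sub>m m 1" "mat_adjoint (0\<^sub>m m 1 :: complex mat) = 0\<^sub>m 1 m"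
      by (auto intro!: eq_matI)
    have adjY: "mat_adjoint Y = four_block_mat (1\<^sub>m 1) (0\<^sub>m 1 m) (0\<^sub>m m 1) (mat_adjoint V)"
      unfolding Y_def using V z by (subst mat_adjoint_four_block[of _ 1 1 _ m _ m]) auto
    have "mat_adjoint Y * Y = four_block_mat (1\<^sub>m 1) (0\<^sub>m 1 m) (0\<^sub>m m 1) (1\<^sub>m m)"
      unfolding adjY unfolding Y_def using V unitary_matD[OF V(2,1)]
      by (subst mult_four_block_mat[of _ 1 1 _ m _ m _ _ 1 _ m]) auto
    hence "unitary_mat Y" using Y by (auto intro!: unitary_matI)
    have "mat_adjoint Y * A' * Y = four_block_mat (mat 1 1 (\<lambda>_. e)) (0\<^sub>m 1 m) (0\<^sub>m m 1) (mat_adjoint V * A3 * V)"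
      unfolding adjY unfolding Y_def blk using V A3
      apply (subst mult_four_block_mat[of _ 1 1 _ m _ m _ _ 1 _ m]; simp?)
      by (subst mult_four_block_mat[of _ 1 1 _ m _ m _ _ 1 _ m]) auto
    also have "\<dots> = mat_diag ?n (\<lambda>i. complex_of_real (d' i))"
      unfolding D3 by (rule eq_matI) (use e in \<open>auto simp: mat_diag_def d'_def\<close>)
    finally have D: "mat_adjoint (W * Y) * A * (W * Y) = mat_diag ?n (\<lambda>i. complex_of_real (d' i))"
      using A W Y by (simp add: A'_def mat_adjoint_mult[of _ ?n ?n _ ?n] sq_mat_assoc[of _ ?n])
    have U: "W * Y \<in> carrier_mat ?n ?n" "unitary_mat (W * Y)"
      using W Y \<open>unitary_mat Y\<close> unitary_mat_mult by auto
    have "A = (W * Y) * mat_diag ?n (\<lambda>i. complex_of_real (d' i)) * mat_adjoint (W * Y)"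
      using conjugation_iff[OF U A] D by auto
    thus ?case using U by blast
  qed
  thus ?thesis using that by blast
qed

section \<open>Functional calculus and positive definite matrices\<close>

text \<open>Resolves the definite description in \<open>hermitian_fun\<close>: any two unitary
  diagonalizations yield the same matrix, so whichever one is at hand computes the value.\<close>

lemma hermitian_fun_eq:
  assumes U: "U \<in> carrier_mat n n" "unitary_mat U"
    and H: "H = U * mat_diag n (\<lambda>i. complex_of_real (d i)) * mat_adjoint U"
  shows "hermitian_fun f H = U * mat_diag n (\<lambda>i. complex_of_real (f (d i))) * mat_adjoint U"
proof -
  have dim: "dim_row H = n" using H U by simp
  \<comment> \<open>$W = V^* U$ intertwines the two diagonal matrices, so $W_{ij} \ne 0$ forces $d_j = e_i$.\<close>
  have unique: "V * mat_diag n (\<lambda>i. complex_of_real (f (e i))) * mat_adjoint V =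
      U * mat_diag n (\<lambda>i. complex_of_real (f (d i))) * mat_adjoint U"
    if V: "V \<in> carrier_mat n n" "unitary_mat V"
      and HV: "H = V * mat_diag n (\<lambda>i. complex_of_real (e i)) * mat_adjoint V" for V e
  proof -
    note c = unitary_matD[OF U(2,1)] unitary_matD[OF V(2,1)]
    define W where "W = mat_adjoint V * U"
    have W: "W \<in> carrier_mat n n" using U V by (simp add: W_def)
    let ?D = "\<lambda>f. mat_diag n (\<lambda>i. complex_of_real (f i))"
    have "W * ?D d = mat_adjoint V * H * U"
      using U V c unfolding H W_def
      by (simp add: sq_mat_assoc[of _ n] mult_cancel_inverse[of _ _ n] right_mult_one_mat[of _ n n])
    also have "\<dots> = ?D e * W"
      using U V c unfolding HV W_def by (simp add: sq_mat_assoc[of _ n] mult_cancel_inverse[of _ _ n])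
    finally have "W $$ (i, j) * d j = e i * W $$ (i, j)" if "i < n" "j < n" for i j
      unfolding mat_diag_mult_left[OF W] mat_diag_mult_right[OF W]
      using that by (auto dest!: arg_cong[where f = "\<lambda>X. X $$ (i, j)"])
    hence "W $$ (i, j) = 0 \<or> d j = e i" if "i < n" "j < n" for i j
      using that by (metis mult.commute mult_left_cancel of_real_eq_iff)
    \<comment> \<open>Where an entry of \<open>W\<close> is nonzero, the two eigenvalues agree, and
      so do their images under \<open>f\<close>. The intertwining relation therefore survives
      applying \<open>f\<close>.\<close>
    hence comm: "W * ?D (\<lambda>i. f (d i)) = ?D (\<lambda>i. f (e i)) * W"
      unfolding mat_diag_mult_left[OF W] mat_diag_mult_right[OF W]
      by (intro eq_matI) fastforce+
    have "U * ?D (\<lambda>i. f (d i)) * mat_adjoint U = V * (W * ?D (\<lambda>i. f (d i))) * mat_adjoint U"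
      using U V c unfolding W_def by (simp add: sq_mat_assoc[of _ n] mult_cancel_inverse[of _ _ n])
    also have "\<dots> = V * ?D (\<lambda>i. f (e i)) * mat_adjoint V"
      unfolding comm using U V c unfolding W_def
      by (simp add: sq_mat_assoc[of _ n] mult_cancel_inverse[of _ _ n])
    finally show ?thesis ..
  qed
  show ?thesis
    unfolding hermitian_fun_def dim
    by (rule the_equality) (use U H unique in blast)+
qed

text \<open>The form of the new matrix at \<open>v\<close> is the form of \<open>A\<close> at
  \<open>P *\<^sub>v v\<close>, and this vector is nonzero because \<open>Q\<close> recovers
  \<open>v\<close> from it.\<close>

lemma hpd_mat_congruence:
  assumes A: "A \<in> carrier_mat n n" "hpd_mat A"
    and P: "P \<in> carrier_mat n n" and Q: "Q \<in> carrier_mat n n" "Q * P = 1\<^sub>m n"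
  shows "hpd_mat (mat_adjoint P * A * P)"
proof -
  let ?M = "mat_adjoint P * A * P"
  have M: "?M \<in> carrier_mat n n" using A P by simp
  have "mat_adjoint A = A" using A by (auto simp: hpd_mat_def hermitian_mat_def)
  hence "mat_adjoint ?M = ?M"
    using A P by (simp add: mat_adjoint_mult[of _ n n _ n] sq_mat_assoc[of _ n])
  moreover have "Re ((?M *\<^sub>v v) \<bullet>c v) > 0" if v: "v \<in> carrier_vec n" "v \<noteq> 0\<^sub>v n" for v
  proof -
    have Pv: "P *\<^sub>v v \<in> carrier_vec n" using P v by simp
    have "Q *\<^sub>v (P *\<^sub>v v) = v"
      using Q P v by (simp flip: assoc_mult_mat_vec)
    moreover have "Q *\<^sub>v 0\<^sub>v n = 0\<^sub>v n" using Q(1) by (intro eq_vecI) auto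
    ultimately have "P *\<^sub>v v \<noteq> 0\<^sub>v n" using v by auto
    hence "Re ((A *\<^sub>v (P *\<^sub>v v)) \<bullet>c (P *\<^sub>v v)) > 0"
      using A Pv by (auto simp: hpd_mat_def)
    also have "(A *\<^sub>v (P *\<^sub>v v)) \<bullet>c (P *\<^sub>v v) = (mat_adjoint P *\<^sub>v (A *\<^sub>v (P *\<^sub>v v))) \<bullet>c v"
      using cscalar_prod_mat_adjoint[OF P _ v(1)] A Pv by simp
    also have "mat_adjoint P *\<^sub>v (A *\<^sub>v (P *\<^sub>v v)) = ?M *\<^sub>v v"
      using A P v by (simp add: assoc_mult_mat_vec[of _ n n _ n])
    finally show ?thesis .
  qed
  ultimately show ?thesis using M by (auto simp: hpd_mat_def hermitian_mat_def)
qed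

text \<open>The diagonal factor is itself congruent to \<open>A\<close>, hence positive definite;
  evaluating its form at the unit vectors gives the positivity of each \<open>d i\<close>.\<close>

lemma hpd_mat_spectral:
  assumes A: "A \<in> carrier_mat n n" "hpd_mat A"
  obtains U d where "U \<in> carrier_mat n n" "unitary_mat U" "\<And>i. i < n \<Longrightarrow> d i > 0"
    "A = U * mat_diag n (\<lambda>i. complex_of_real (d i)) * mat_adjoint U"
proof -
  have "mat_adjoint A = A" using A by (auto simp: hpd_mat_def hermitian_mat_def)
  then obtain U d where U: "U \<in> carrier_mat n n" "unitary_mat U"
    and eq: "A = U * mat_diag n (\<lambda>i. complex_of_real (d i)) * mat_adjoint U"
    using spectral_theorem_hermitian[OF A(1)] by blast
  let ?D = "mat_diag n (\<lambda>i. complex_of_real (d i))"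
  have "mat_adjoint U * A * U = ?D" using conjugation_iff[OF U A(1), of ?D] eq by simp
  hence hpd: "hpd_mat ?D"
    using hpd_mat_congruence[OF A U(1) _ unitary_matD(1)[OF U(2,1)]] U by auto
  have "d i > 0" if i: "i < n" for i
  proof -
    have dD: "dim_row ?D = n" by (simp add: mat_diag_def)
    have "(unit_vec n i :: complex vec) \<noteq> 0\<^sub>v n"
      using i by (auto simp: vec_eq_iff)
    hence "Re ((?D *\<^sub>v unit_vec n i) \<bullet>c unit_vec n i) > 0"
      using hpd unfolding hpd_mat_def dD by auto
    moreover have "conjugate (unit_vec n i :: complex vec) = unit_vec n i"
      by (auto simp: vec_eq_iff unit_vec_def)
    ultimately show ?thesis using i by (simp add: mat_diag_def)
  qed
  thus ?thesis using that U eq by blast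
qed

section \<open>Frobenius norm, determinant and spectrum under diagonalization\<close>

lemma frobenius_norm_adjoint: "frobenius_norm (mat_adjoint A) = frobenius_norm A"
  unfolding frobenius_norm_def by (subst sum.swap) simp

text \<open>Written as the trace of \<open>mat_adjoint A * A\<close>, the norm is visibly unchanged
  by a unitary left factor, which cancels inside that product.\<close>

lemma frobenius_norm_sq_trace:
  "complex_of_real ((frobenius_norm A)\<^sup>2) = (\<Sum>j<dim_col A. (mat_adjoint A * A) $$ (j, j))"
proof -
  have "(frobenius_norm A)\<^sup>2 = (\<Sum>j<dim_col A. \<Sum>i<dim_row A. (cmod (A $$ (i, j)))\<^sup>2)"
    unfolding frobenius_norm_def by (subst sum.swap) (simp add: sum_nonneg)
  also have "complex_of_real \<dots> =
      (\<Sum>j<dim_col A. \<Sum>i<dim_row A. cnj (A $$ (i, j)) * A $$ (i, j))"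
    unfolding of_real_sum complex_norm_square by (simp only: mult.commute)
  finally show ?thesis
    by (simp add: scalar_prod_def atLeast0LessThan)
qed

lemma frobenius_norm_nonneg: "frobenius_norm A \<ge> 0"
  by (simp add: frobenius_norm_def sum_nonneg)

lemma frobenius_norm_unitary_mult:
  assumes U: "U \<in> carrier_mat n n" "unitary_mat U" and A: "A \<in> carrier_mat n n"
  shows "frobenius_norm (U * A) = frobenius_norm A"
proof -
  have "mat_adjoint (U * A) * (U * A) = mat_adjoint A * A"
    using U A unitary_matD[OF U(2,1)]
    by (simp add: mat_adjoint_mult[of _ n n _ n] sq_mat_assoc[of _ n] mult_cancel_inverse[of _ _ n])
  hence "complex_of_real ((frobenius_norm (U * A))\<^sup>2) = complex_of_real ((frobenius_norm A)\<^sup>2)"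
    unfolding frobenius_norm_sq_trace by simp
  thus ?thesis by (simp only: of_real_eq_iff power2_eq_iff_nonneg frobenius_norm_nonneg)
qed

text \<open>The left factor drops out by unitary invariance. Passing to the adjoint turns the right
  factor into a left one, since a real diagonal matrix is self-adjoint, and it drops out in the same
  way.\<close>

lemma frobenius_norm_sq_unitary_diag:
  assumes U: "U \<in> carrier_mat n n" "unitary_mat U"
  shows "(frobenius_norm (U * mat_diag n (\<lambda>i. complex_of_real (d i)) * mat_adjoint U))\<^sup>2 = (\<Sum>i<n. (d i)\<^sup>2)"
proof -
  let ?D = "mat_diag n (\<lambda>i. complex_of_real (d i))"
  have "frobenius_norm (U * ?D * mat_adjoint U) = frobenius_norm (?D * mat_adjoint U)"
    using U by (simp add: sq_mat_assoc[of _ n] frobenius_norm_unitary_mult[of _ n])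
  also have "\<dots> = frobenius_norm (U * ?D)"
    using U by (subst frobenius_norm_adjoint[symmetric]) (simp add: mat_adjoint_mult[of _ n n _ n])
  also have "\<dots> = frobenius_norm ?D"
    using U by (simp add: frobenius_norm_unitary_mult[of _ n])
  also have "(frobenius_norm ?D)\<^sup>2 = (\<Sum>i<n. \<Sum>j<n. if i = j then (d i)\<^sup>2 else 0)"
    by (auto simp: frobenius_norm_def sum_nonneg mat_diag_def if_distrib[of "\<lambda>x. (cmod x)\<^sup>2"] cong: if_cong intro!: sum.cong)
  finally show ?thesis by simp
qed

lemma det_mat_diag: "det (mat_diag n f :: complex mat) = (\<Prod>i<n. f i)"
proof -
  have "diag_mat (mat_diag n f) = map f [0..<n]" by (auto simp: mat_diag_def diag_mat_def)
  moreover have "prod_list (map f [0..<n]) = (\<Prod>i<n. f i)" by (induction n) auto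
  ultimately show ?thesis
    by (subst det_upper_triangular[of _ n]) (auto simp: mat_diag_def upper_triangular_def)
qed

lemma det_unitary_conjugate:
  assumes U: "U \<in> carrier_mat n n" "unitary_mat U" and D: "D \<in> carrier_mat n n"
  shows "det (U * D * mat_adjoint U) = det D"
proof -
  have "det U * det (mat_adjoint U) = 1"
    using U det_mult[of U n "mat_adjoint U"] unitary_matD[OF U(2,1)] by simp
  thus ?thesis using U D by (simp add: det_mult[of _ n])
qed

lemma spectrum_mat_diag:
  "spectrum (mat_diag n f :: complex mat) = f ` {..<n}"
proof -
  have "poly (char_poly (mat_diag n f)) k = 0 \<longleftrightarrow> (\<exists>i<n. k = f i)" for k
    by (subst char_poly_upper_triangular[of _ n])
      (auto simp: mat_diag_def diag_mat_def upper_triangular_def poly_prod_list prod_list_zero_iff)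
  thus ?thesis by (auto simp: spectrum_root_char_poly[OF mat_diag_dim])
qed

section \<open>Scalar inequalities\<close>

text \<open>After taking logarithms, the difference of the two sides vanishes at 0 and has
  derivative \<open>t - tanh t\<close>. This in turn vanishes at 0 and has derivative
  \<open>(tanh t)^2\<close>, so both are nonnegative for nonnegative arguments; evenness covers the
  rest.\<close>

lemma cosh_le_exp_half_sq: "cosh x \<le> exp (x\<^sup>2 / 2)" for x :: real
proof -
  have tanh_le: "tanh y \<le> y" if "y \<ge> 0" for y :: real
  proof -
    have "(\<lambda>t. t - tanh t) 0 \<le> (\<lambda>t. t - tanh t) y"
      by (rule DERIV_nonneg_imp_nondecreasing[OF that])
        (auto intro!: exI derivative_eq_intros simp: cosh_real_nonzero)
    thus ?thesis by simp
  qed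
  have main: "ln (cosh x) \<le> x\<^sup>2 / 2" if "x \<ge> 0" for x :: real
  proof -
    have "(\<lambda>t. t\<^sup>2 / 2 - ln (cosh t)) 0 \<le> (\<lambda>t. t\<^sup>2 / 2 - ln (cosh t)) x"
    proof (rule DERIV_nonneg_imp_nondecreasing[OF that])
      fix t :: real assume "0 \<le> t"
      hence "t - tanh t \<ge> 0" using tanh_le by simp
      moreover have "((\<lambda>t. t\<^sup>2 / 2 - ln (cosh t)) has_real_derivative t - tanh t) (at t)"
        by (auto intro!: derivative_eq_intros simp: tanh_def cosh_real_pos field_simps)
      ultimately show "\<exists>D. ((\<lambda>t. t\<^sup>2 / 2 - ln (cosh t)) has_real_derivative D) (at t) \<and> 0 \<le> D"
        by blast
    qed
    thus ?thesis by simp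
  qed
  have "ln (cosh x) \<le> x\<^sup>2 / 2" using main[of "\<bar>x\<bar>"] by simp
  hence "exp (ln (cosh x)) \<le> exp (x\<^sup>2 / 2)" by (subst exp_le_cancel_iff)
  thus ?thesis unfolding exp_ln[OF cosh_real_pos] .
qed

text \<open>For \<open>x = exp (2 * y)\<close> the divergence is \<open>ln (cosh y)\<close>, which
  is at most \<open>y^2 / 2 = (ln x)^2 / 8\<close>; this is the source of the constant 8.\<close>

lemma S_divergence_le_log_sq:
  assumes "x > (0::real)"
  shows "8 * (ln ((1 + x) / 2) - ln x / 2) \<le> (ln x)\<^sup>2"
proof -
  define y where "y = ln x / 2"
  have "x = exp y * exp y" using assms by (simp add: y_def flip: exp_add)
  hence "(1 + x) / 2 = exp y * cosh y" by (simp add: cosh_def exp_minus field_simps)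
  hence "ln ((1 + x) / 2) - ln x / 2 = ln (cosh y)"
    using cosh_real_pos[of y] by (simp add: ln_mult y_def)
  also have "\<dots> \<le> ln (exp (y\<^sup>2 / 2))"
    using cosh_le_exp_half_sq cosh_real_pos by (subst ln_le_cancel_iff) auto
  finally show ?thesis by (simp add: y_def power2_eq_square)
qed

text \<open>The term \<open>ln 2\<close> undoes the halving, so the right side is
  \<open>2 * ln (1 + x) - ln x\<close>. The two signs of \<open>ln x\<close> then need only
  \<open>ln x \<le> ln (1 + x)\<close> and \<open>0 \<le> ln (1 + x)\<close>.\<close>

lemma abs_ln_le_S_divergence:
  assumes "x > (0::real)"
  shows "\<bar>ln x\<bar> \<le> 2 * (ln ((1 + x) / 2) - ln x / 2 + ln 2)"
proof -
  have "ln x \<le> ln (1 + x)" "0 \<le> ln (1 + x)" using assms by auto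
  moreover have "2 * (ln ((1 + x) / 2) - ln x / 2 + ln 2) = 2 * ln (1 + x) - ln x"
    using assms by (simp add: ln_div)
  ultimately show ?thesis by linarith
qed

section \<open>Reduction of the three distances to eigenvalues\<close>

text \<open>Congruence by \<open>S\<close>, the inverse square root of \<open>B\<close>, sends
  \<open>B\<close> to the identity, \<open>A\<close> to \<open>M\<close> and \<open>A + B\<close> to
  \<open>M + 1\<close>. The \<open>l i\<close> are the eigenvalues of \<open>M\<close> with
  multiplicity; the determinants are compared through the congruence, the spectrum through a
  similarity.\<close>

lemma common_diagonalization:
  assumes A: "A \<in> carrier_mat n n" "hpd_mat A" and B: "B \<in> carrier_mat n n" "hpd_mat B"
  obtains l where "\<And>i. i < n \<Longrightarrow> l i > 0"
    "(delta_R A B)\<^sup>2 = (\<Sum>i<n. (ln (l i))\<^sup>2)"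
    "delta_S_sq A B = (\<Sum>i<n. ln ((1 + l i) / 2) - ln (l i) / 2)"
    "delta_T A B = Max ((\<lambda>i. \<bar>ln (l i)\<bar>) ` {..<n})"
proof -
  let ?D = "\<lambda>f. mat_diag n (\<lambda>i. complex_of_real (f i))"
  obtain U b where U: "U \<in> carrier_mat n n" "unitary_mat U" and b: "\<And>i. i < n \<Longrightarrow> b i > 0"
    and BU: "B = U * ?D b * mat_adjoint U"
    using hpd_mat_spectral[OF B] by metis
  note UU = unitary_matD[OF U(2,1)]
  define s where "s i = b i powr (- 1 / 2)" for i
  define S where "S = U * ?D s * mat_adjoint U"
  have S: "S \<in> carrier_mat n n" using U by (simp add: S_def)
  have invB: "inv_sqrt_mat B = S"
    unfolding inv_sqrt_mat_def S_def s_def by (rule hermitian_fun_eq[OF U BU])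
  have adjS: "mat_adjoint S = S"
    using U by (simp add: S_def mat_adjoint_mult[of _ n n _ n] sq_mat_assoc[of _ n])
  have sbs: "s i * (b i * s i) = 1" if "i < n" for i
    using b[OF that] unfolding s_def
    by (simp add: powr_minus powr_half_sqrt field_simps)
  have "S * B * S = U * (?D s * (?D b * ?D s)) * mat_adjoint U"
    using U UU by (simp only: S_def BU sq_mat_assoc[of _ n] mult_cancel_inverse[of _ _ n] sq_mult_carrier mat_adjoint_carrier mat_diag_dim)
  also have "?D s * (?D b * ?D s) = 1\<^sub>m n"
    unfolding mat_diag_diag of_real_mult[symmetric] using sbs
    by (auto simp: mat_diag_def simp del: of_real_mult intro!: eq_matI)
  finally have SBS: "S * B * S = 1\<^sub>m n" using U UU by simp
  hence SBS': "S * (B * S) = 1\<^sub>m n" using S B by (simp add: sq_mat_assoc[of _ n])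
  \<comment> \<open>For square matrices a one-sided inverse is two-sided. So \<open>B * S\<close> is
    the inverse of \<open>S\<close>, both as the witness needed for the congruence and later for the
    similarity.\<close>
  have BSS: "B * S * S = 1\<^sub>m n"
    by (rule mat_mult_left_right_inverse[OF _ _ SBS']) (use S B in auto)
  define M where "M = S * A * S"
  have M: "M \<in> carrier_mat n n" using S A by (simp add: M_def)
  have "hpd_mat M"
    using hpd_mat_congruence[OF A S _ BSS] S B adjS by (simp add: M_def)
  then obtain V l where V: "V \<in> carrier_mat n n" "unitary_mat V" and l: "\<And>i. i < n \<Longrightarrow> l i > 0"
    and MV: "M = V * ?D l * mat_adjoint V"
    using hpd_mat_spectral[OF M] by metis
  note VV = unitary_matD[OF V(2,1)]
  have "delta_R A B = frobenius_norm (V * ?D (\<lambda>i. ln (l i)) * mat_adjoint V)"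
    using hermitian_fun_eq[OF V MV, of ln] by (simp add: delta_R_def invB M_def log_mat_def)
  hence R: "(delta_R A B)\<^sup>2 = (\<Sum>i<n. (ln (l i))\<^sup>2)"
    using frobenius_norm_sq_unitary_diag[OF V, of "\<lambda>i. ln (l i)"] by simp

  define bt where "bt = (\<Prod>i<n. b i)"
  have bt: "bt > 0" using b by (auto simp: bt_def intro!: prod_pos)
  have detB: "det B = complex_of_real bt"
    using det_unitary_conjugate[OF U, of "?D b"] by (simp add: BU det_mat_diag bt_def)
  have inv: "det S * det B * det S = 1"
    using arg_cong[OF SBS, of det] S B by (simp add: det_mult[of _ n] mult.assoc)
  have detM: "det S * det A * det S = complex_of_real (\<Prod>i<n. l i)"
  proof -
    have "det M = complex_of_real (\<Prod>i<n. l i)"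
      using det_unitary_conjugate[OF V, of "?D l"] by (simp add: MV det_mat_diag)
    thus ?thesis using S A by (simp add: M_def det_mult[of _ n] mult.assoc)
  qed
  have "S * (A + B) * S = M + 1\<^sub>m n"
    using S A B SBS
    by (simp add: M_def mult_add_distrib_mat[of _ n n _ n] add_mult_distrib_mat[of _ n n _ _ n])
  also have "\<dots> = V * ?D (\<lambda>i. 1 + l i) * mat_adjoint V"
  proof -
    have "?D (\<lambda>i. 1 + l i) = ?D l + 1\<^sub>m n" by (rule eq_matI) (auto simp: mat_diag_def)
    thus ?thesis using V VV MV
      by (simp add: mult_add_distrib_mat[of _ n n _ n] add_mult_distrib_mat[of _ n n _ _ n])
  qed
  finally have "det (S * (A + B) * S) = complex_of_real (\<Prod>i<n. 1 + l i)"
    using det_unitary_conjugate[OF V, of "?D (\<lambda>i. 1 + l i)"] by (simp add: det_mat_diag)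
  hence detAB: "det S * det (A + B) * det S = complex_of_real (\<Prod>i<n. 1 + l i)"
    using S A B by (simp add: det_mult[of _ n] mult.assoc)
  \<comment> \<open>By \<open>inv\<close>, the square of \<open>det S\<close> is the reciprocal of
    \<open>det B\<close>, so undoing the congruence multiplies a determinant by \<open>bt\<close>;
    \<open>det S\<close> itself is never computed.\<close>
  have rescale: "det X = complex_of_real (bt * x)" if "det S * det X * det S = complex_of_real x" for X x
  proof -
    have "det X = (det S * det B * det S) * det X" using inv by simp
    also have "\<dots> = det B * (det S * det X * det S)" by (simp add: mult_ac)
    finally show ?thesis using that detB by simp
  qed
  have det1: "det ((1 / 2) \<cdot>\<^sub>m (A + B)) = complex_of_real (bt * (\<Prod>i<n. (1 + l i) / 2))"
  proof -
    have "det ((1 / 2) \<cdot>\<^sub>m (A + B)) = complex_of_real ((1 / 2) ^ n) * det (A + B)"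
      using A B by simp
    also have "\<dots> = complex_of_real ((1 / 2) ^ n * (bt * (\<Prod>i<n. 1 + l i)))"
      unfolding rescale[OF detAB] of_real_mult ..
    also have "(1 / 2) ^ n * (bt * (\<Prod>i<n. 1 + l i)) = bt * (\<Prod>i<n. (1 + l i) / 2)"
      by (simp add: prod_dividef power_one_over)
    finally show ?thesis .
  qed
  have det2: "det (A * B) = complex_of_real (bt\<^sup>2 * (\<Prod>i<n. l i))"
    using rescale[OF detM] detB A B by (simp add: det_mult[of _ n] power2_eq_square)
  have l0: "l i \<noteq> 0" "1 + l i \<noteq> 0" if "i < n" for i
    using l[OF that] by linarith+
  have lp: "(\<Prod>i<n. l i) \<noteq> 0" "(\<Prod>i<n. (1 + l i) / 2) \<noteq> 0"
    using l0 by auto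
  have "ln (\<Prod>i<n. l i) = (\<Sum>i<n. ln (l i))"
    by (rule ln_prod) (use l0 in auto)
  moreover have "ln (\<Prod>i<n. (1 + l i) / 2) = (\<Sum>i<n. ln ((1 + l i) / 2))"
    by (rule ln_prod) (use l0 in auto)
  moreover have "(\<Sum>i<n. ln ((1 + l i) / 2) - ln (l i) / 2) =
      (\<Sum>i<n. ln ((1 + l i) / 2)) - (\<Sum>i<n. ln (l i)) / 2"
    by (simp add: sum_subtractf sum_divide_distrib)
  \<comment> \<open>The factor \<open>bt\<close> cancels: it contributes \<open>ln bt\<close> to the
    first logarithm and half of \<open>2 * ln bt\<close> to the second.\<close>
  ultimately have Ssq: "delta_S_sq A B = (\<Sum>i<n. ln ((1 + l i) / 2) - ln (l i) / 2)"
    unfolding delta_S_sq_def det1 det2 Re_complex_of_real using bt lp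
    by (simp add: ln_mult ln_realpow add_divide_distrib del: of_real_prod)

  have "det B \<noteq> 0" using detB bt by simp
  hence "mat_inverse B \<noteq> None"
    \<comment> \<open>Both facts concern units of a matrix ring carrying a dummy parameter
      \<open>b\<close>; fixing it to \<open>()\<close> makes them speak of the same ring.\<close>
    using det_non_zero_imp_unit[OF B(1), where b = "()"] mat_inverse(1)[OF B(1), where b = "()"] by blast
  then obtain C where C: "mat_inverse B = Some C" by auto
  have Cc: "C \<in> carrier_mat n n" and CB: "C * B = 1\<^sub>m n"
    using mat_inverse(2)[OF B(1) C] by auto
  \<comment> \<open>Inserting \<open>C * B\<close> before the right factor \<open>S\<close> rewrites
    \<open>M\<close> as \<open>S * (A * C) * (B * S)\<close>. As \<open>B * S\<close> inverts
    \<open>S\<close>, this exhibits \<open>M\<close> as similar to \<open>A * C\<close>, whose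
    spectrum enters \<open>delta_T\<close>.\<close>
  have "C * (B * S) = S" by (rule mult_cancel_inverse[OF CB Cc B(1) S])
  hence "M = S * (A * C) * (B * S)"
    using S A B Cc by (simp add: M_def sq_mat_assoc[of _ n])
  hence "similar_mat_wit M (A * C) S (B * S)"
    by (rule similar_mat_witI[OF SBS' BSS _ M]) (use S A B Cc in auto)
  moreover have "similar_mat_wit M (?D l) V (mat_adjoint V)"
    by (rule similar_mat_witI[OF VV(2,1) MV M]) (use V in auto)
  ultimately have "char_poly (A * C) = char_poly (?D l)"
    using char_poly_similar by (metis similar_mat_def)
  hence "spectrum (A * C) = spectrum (?D l)"
    using A Cc by (simp add: spectrum_root_char_poly[of _ n])
  hence "spectrum (A * C) = (\<lambda>i. complex_of_real (l i)) ` {..<n}"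
    by (simp add: spectrum_mat_diag)
  hence T: "delta_T A B = Max ((\<lambda>i. \<bar>ln (l i)\<bar>) ` {..<n})"
    by (simp add: delta_T_def C image_image)
  show ?thesis by (rule that[OF l R Ssq T])
qed

section \<open>The two inequalities, by summation over eigenvalues\<close>

theorem theorem4p19:
  fixes n :: nat and A B :: "complex mat"
  assumes "A \<in> carrier_mat n n" and "B \<in> carrier_mat n n"
    and "hpd_mat A" and "hpd_mat B"
  shows "8 * delta_S_sq A B \<le> (delta_R A B)\<^sup>2 \<and>
    (delta_R A B)\<^sup>2 \<le> 2 * delta_T A B * (delta_S_sq A B + real n * ln 2)"
proof -
  obtain l where l: "\<And>i. i < n \<Longrightarrow> l i > 0"
    and R: "(delta_R A B)\<^sup>2 = (\<Sum>i<n. (ln (l i))\<^sup>2)"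
    and S: "delta_S_sq A B = (\<Sum>i<n. ln ((1 + l i) / 2) - ln (l i) / 2)"
    and T: "delta_T A B = Max ((\<lambda>i. \<bar>ln (l i)\<bar>) ` {..<n})"
    using common_diagonalization[OF assms(1,3,2,4)] by blast
  have "8 * delta_S_sq A B \<le> (delta_R A B)\<^sup>2"
    unfolding R S sum_distrib_left by (intro sum_mono S_divergence_le_log_sq l) simp
  \<comment> \<open>The term \<open>real n * ln 2\<close> is spread out as one \<open>ln 2\<close>
    per eigenvalue. For \<open>n = 0\<close> the maximum in \<open>delta_T\<close> is over the empty
    set, but its value does not matter: the bound \<open>le\<close> is used only at an index below
    \<open>n\<close>, and both sums are empty.\<close>
  moreover have "(delta_R A B)\<^sup>2 \<le>
    (\<Sum>i<n. 2 * delta_T A B * (ln ((1 + l i) / 2) - ln (l i) / 2 + ln 2))"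
    unfolding R
  proof (rule sum_mono)
    fix i assume "i \<in> {..<n}"
    hence i: "i < n" by simp
    have le: "\<bar>ln (l i)\<bar> \<le> delta_T A B" unfolding T using i by (intro Max_ge) auto
    have "(ln (l i))\<^sup>2 = \<bar>ln (l i)\<bar> * \<bar>ln (l i)\<bar>" by (simp add: power2_eq_square)
    \<comment> \<open>Multiplying the bounds requires \<open>delta_T A B\<close> to be nonnegative,
      which follows from \<open>le\<close> because it dominates an absolute value.\<close>
    also have "\<dots> \<le> delta_T A B * (2 * (ln ((1 + l i) / 2) - ln (l i) / 2 + ln 2))"
      using le by (intro mult_mono abs_ln_le_S_divergence l i) auto
    finally show "(ln (l i))\<^sup>2 \<le> 2 * delta_T A B * (ln ((1 + l i) / 2) - ln (l i) / 2 + ln 2)"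
      by (simp add: mult_ac)
  qed
  moreover have "(\<Sum>i<n. 2 * delta_T A B * (ln ((1 + l i) / 2) - ln (l i) / 2 + ln 2)) =
      2 * delta_T A B * (delta_S_sq A B + real n * ln 2)"
    unfolding S sum_distrib_left[symmetric] sum.distrib by simp
  ultimately show ?thesis by simp
qed

end
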